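(* If $n$ is a positive integer and $p$, $q$ and $t$ are any integers, then $$\sum_{k=0}^n\frac{(-1)^{(n-k)q}\,n}{n+k}\binom{n+k}{n-k}F_{p+q}^{n-k}F_p^{n-k}F_q^{2k}L_{k(2p+q)+t}=\frac12\left(F_{p+q}^{2n}L_{t+qn}+F_p^{2n}L_{t-qn}\right),$$ $$\sum_{k=0}^n\frac{(-1)^{(n-k)q}\,n}{n+k}\binom{n+k}{n-k}F_{p+q}^{n-k}F_p^{n-k}F_q^{2k}F_{k(2p+q)+t}=\frac12\left(F_{p+q}^{2n}F_{t+qn}+F_p^{2n}F_{t-qn}\right),$$ $$\sum_{k=0}^n\frac{(-1)^{(n-k)q}\,n}{n+k}\binom{n+k}{n-k}5^kL_{p+q}^{n-k}L_p^{n-k}F_q^{2k}L_{k(2p+q)+t}=\frac12\left(L_{p+q}^{2n}L_{t+qn}+L_p^{2n}L_{t-qn}\right),$$ $$\sum_{k=0}^n\frac{(-1)^{(n-k)q}\,n}{n+k}\binom{n+k}{n-k}5^kL_{p+q}^{n-k}L_p^{n-k}F_q^{2k}F_{k(2p+q)+t}=\frac12\left(L_{p+q}^{2n}F_{t+qn}+L_p^{2n}F_{t-qn}\right).$$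
   Context: $F_n$ and $L_n$ ($n\in\mathbb{Z}$) are the Fibonacci and Lucas numbers: $F_0=0$, $F_1=1$, $F_n=F_{n-1}+F_{n-2}$; $L_0=2$, $L_1=1$, $L_n=L_{n-1}+L_{n-2}$, extended to negative indices by $F_{-n}=(-1)^{n-1}F_n$, $L_{-n}=(-1)^nL_n$. The convention $0^0=1$ is used. *)

theory Defs
  imports "HOL-Number_Theory.Fib"
begin

fun lucas :: "nat \<Rightarrow> nat" where
  "lucas 0 = 2"
| "lucas (Suc 0) = 1"
| "lucas (Suc (Suc n)) = lucas (Suc n) + lucas n"

(* Negative indices follow F(-m) = (-1)^(m-1) F(m) and L(-m) = (-1)^m L(m) with m = nat (-n);
   the natural-number subtraction m - 1 never truncates, since m > 0 in that branch. *)

definition fibZ :: "int \<Rightarrow> int" where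
  "fibZ n = (if 0 \<le> n then int (fib (nat n))
             else (-1) ^ (nat (- n) - 1) * int (fib (nat (- n))))"

definition lucasZ :: "int \<Rightarrow> int" where
  "lucasZ n = (if 0 \<le> n then int (lucas (nat n))
               else (-1) ^ nat (- n) * int (lucas (nat (- n))))"

lemma fibZ_of_nat [simp]: "fibZ (int n) = int (fib n)"
  by (simp add: fibZ_def)

lemma lucasZ_of_nat [simp]: "lucasZ (int n) = int (lucas n)"
  by (simp add: lucasZ_def)

lemma fibZ_neg_of_nat: "n > 0 \<Longrightarrow> fibZ (- int n) = (-1) ^ (n - 1) * fibZ (int n)"
  by (simp add: fibZ_def)

lemma lucasZ_neg_of_nat: "lucasZ (- int n) = (-1) ^ n * lucasZ (int n)"
  by (simp add: lucasZ_def)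

lemma fibZ_rec: "fibZ n = fibZ (n - 1) + fibZ (n - 2)"
proof -
  consider (pos) m where "n = int m + 2" | (one) "n = 1" | (zero) "n = 0"
    | (neg) m where "n = - int m - 1"
  proof (cases "n \<ge> 2")
    case True
    then have "n = int (nat (n - 2)) + 2" by simp
    then show thesis by (rule pos)
  next
    case False
    then consider "n = 1" | "n = 0" | "n = - int (nat (- n - 1)) - 1" by linarith
    then show thesis by cases (fact one, fact zero, rule neg)
  qed
  then show ?thesis
  proof cases
    case pos
    then have "n = int (Suc (Suc m))" "n - 1 = int (Suc m)" "n - 2 = int m" by simp_all
    then show ?thesis by (simp only: fibZ_of_nat fib2 of_nat_add)
  next
    case one
    then show ?thesis by (simp add: fibZ_def)
  next
    case zero
    then show ?thesis by (simp add: fibZ_def numeral_2_eq_2)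
  next
    case neg
    then have "n = - int (Suc m)" "n - 1 = - int (Suc (Suc m))"
      "n - 2 = - int (Suc (Suc (Suc m)))" by simp_all
    then show ?thesis
      by (simp only: fibZ_neg_of_nat zero_less_Suc fibZ_of_nat fib2 of_nat_add diff_Suc_1)
        (simp add: algebra_simps)
  qed
qed

lemma lucasZ_rec: "lucasZ n = lucasZ (n - 1) + lucasZ (n - 2)"
proof -
  consider (pos) m where "n = int m + 2" | (one) "n = 1" | (zero) "n = 0"
    | (neg) m where "n = - int m - 1"
  proof (cases "n \<ge> 2")
    case True
    then have "n = int (nat (n - 2)) + 2" by simp
    then show thesis by (rule pos)
  next
    case False
    then consider "n = 1" | "n = 0" | "n = - int (nat (- n - 1)) - 1" by linarith
    then show thesis by cases (fact one, fact zero, rule neg)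
  qed
  then show ?thesis
  proof cases
    case pos
    then have "n = int (Suc (Suc m))" "n - 1 = int (Suc m)" "n - 2 = int m" by simp_all
    then show ?thesis by (simp only: lucasZ_of_nat lucas.simps(3) of_nat_add)
  next
    case one
    then show ?thesis by (simp add: lucasZ_def)
  next
    case zero
    then show ?thesis by (simp add: lucasZ_def numeral_2_eq_2)
  next
    case neg
    then have "n = - int (Suc m)" "n - 1 = - int (Suc (Suc m))"
      "n - 2 = - int (Suc (Suc (Suc m)))" by simp_all
    then show ?thesis
      by (simp only: lucasZ_neg_of_nat lucasZ_of_nat lucas.simps(3) of_nat_add)
        (simp add: algebra_simps)
  qed
qed

end

theory Submission
  imports Defs
begin

text \<open>
  All four identities are instances of
  \<open>\<Sum>k\<le>n. n / (n + k) * (n + k choose n - k) * (x * y) ^ (n - k) * (x - y) ^ (2 * k)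
    = (x ^ (2 * n) + y ^ (2 * n)) / 2\<close>,
  which holds because both sides satisfy the same second-order recurrence in \<open>n\<close>. Let \<open>r\<close> be
  either root of \<open>r\<^sup>2 = r + 1\<close>. Put \<open>x = F(p + q) * r powi q\<close> and
  \<open>y = (-1) powi q * F(p)\<close>, so that \<open>x - y = F(q) * r powi (p + q)\<close> by Binet's formula; with
  \<open>L\<close> in place of \<open>F\<close> in \<open>x\<close> and \<open>y\<close>, the difference is
  \<open>\<plusminus> sqrt 5 * F(q) * r powi (p + q)\<close>. Multiplying by \<open>r powi (t - q * n)\<close> and combining
  the two roots by Binet's formula gives the theorem.
\<close>

subsection \<open>A Waring-type identity\<close>

text \<open>Homogenised Morgan-Voyce polynomials: \<open>P = 1\<close> gives b_n(S) here and B_n(S)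
  for \<open>odd_binomial_sum\<close>. The lower index \<open>2 * k\<close>, rather than
  \<open>n - k\<close>, lets Pascal's rule link the two families.\<close>

definition even_binomial_sum :: "nat \<Rightarrow> real \<Rightarrow> real \<Rightarrow> real" where
  "even_binomial_sum n P S = (\<Sum>k\<le>n. real ((n + k) choose (2 * k)) * P ^ (n - k) * S ^ k)"

definition odd_binomial_sum :: "nat \<Rightarrow> real \<Rightarrow> real \<Rightarrow> real" where
  "odd_binomial_sum n P S = (\<Sum>k\<le>n. real (Suc (n + k) choose Suc (2 * k)) * P ^ (n - k) * S ^ k)"

text \<open>The added term \<open>k = Suc n\<close> vanishes because its lower index exceeds its
  upper one; the longer range allows termwise combination with sums of index
  \<open>Suc n\<close>.\<close>

lemma mult_even_binomial_sum:
  "P * even_binomial_sum n P S =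
    (\<Sum>k\<le>Suc n. real ((n + k) choose (2 * k)) * P ^ (Suc n - k) * S ^ k)"
  by (simp add: even_binomial_sum_def sum_distrib_left Suc_diff_le mult_ac binomial_eq_0)

lemma mult_odd_binomial_sum:
  "P * odd_binomial_sum n P S =
    (\<Sum>k\<le>Suc n. real (Suc (n + k) choose Suc (2 * k)) * P ^ (Suc n - k) * S ^ k)"
  by (simp add: odd_binomial_sum_def sum_distrib_left Suc_diff_le mult_ac binomial_eq_0)

lemma odd_binomial_sum_Suc:
  "odd_binomial_sum (Suc n) P S = P * odd_binomial_sum n P S + even_binomial_sum (Suc n) P S"
  unfolding mult_odd_binomial_sum
  unfolding odd_binomial_sum_def even_binomial_sum_def sum.distrib [symmetric]
  by (intro sum.cong) (simp_all add: algebra_simps)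

text \<open>Pascal's rule splits off a binomial with lower index \<open>2 * k - 1\<close>; shifting
  \<open>k\<close> by one turns that part into \<open>S\<close> times the odd sum.\<close>

lemma even_binomial_sum_Suc:
  "even_binomial_sum (Suc n) P S = P * even_binomial_sum n P S + S * odd_binomial_sum n P S"
  unfolding mult_even_binomial_sum
  unfolding even_binomial_sum_def odd_binomial_sum_def sum.atMost_Suc_shift
  by (simp add: algebra_simps sum.distrib sum_distrib_left)

lemma even_binomial_sum_rec:
  "even_binomial_sum (Suc (Suc n)) P S =
    (S + 2 * P) * even_binomial_sum (Suc n) P S - P\<^sup>2 * even_binomial_sum n P S"
proof -
  \<comment> \<open>The odd sum is eliminated between the two Pascal relations.\<close>
  have "S * odd_binomial_sum (Suc n) P S =
      P * (S * odd_binomial_sum n P S) + S * even_binomial_sum (Suc n) P S"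
    by (simp add: odd_binomial_sum_Suc algebra_simps)
  also have "S * odd_binomial_sum n P S = even_binomial_sum (Suc n) P S - P * even_binomial_sum n P S"
    by (simp add: even_binomial_sum_Suc)
  finally show ?thesis
    unfolding even_binomial_sum_Suc [of "Suc n"] by (simp add: algebra_simps power2_eq_square)
qed

text \<open>Here S + 2P = x^2 + y^2 and P^2 = x^2 y^2, so x^2 and y^2 are the characteristic roots
  of \<open>even_binomial_sum_rec\<close>.\<close>

lemma even_binomial_sum_power_sum:
  fixes x y :: real
  shows "even_binomial_sum (Suc n) (x * y) ((x - y)\<^sup>2)
      + x * y * even_binomial_sum n (x * y) ((x - y)\<^sup>2)
    = x ^ (2 * Suc n) + y ^ (2 * Suc n)"
proof (induction n rule: induct_nat_012)
  case 0
  show ?case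
    by (simp add: even_binomial_sum_def power2_eq_square algebra_simps)
next
  case 1
  show ?case
    by (simp add: even_binomial_sum_rec)
      (simp add: even_binomial_sum_def power2_eq_square algebra_simps eval_nat_numeral)
next
  case (ge2 n)
  let ?E = "\<lambda>m. even_binomial_sum m (x * y) ((x - y)\<^sup>2)"
  have "?E (Suc (Suc (Suc n))) + x * y * ?E (Suc (Suc n)) =
      ((x - y)\<^sup>2 + 2 * (x * y)) * (?E (Suc (Suc n)) + x * y * ?E (Suc n))
        - (x * y)\<^sup>2 * (?E (Suc n) + x * y * ?E n)"
    unfolding even_binomial_sum_rec [of "Suc n"] even_binomial_sum_rec [of n]
    by (simp add: algebra_simps)
  also have "\<dots> = ((x - y)\<^sup>2 + 2 * (x * y)) * (x ^ (2 * Suc (Suc n)) + y ^ (2 * Suc (Suc n)))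
        - (x * y)\<^sup>2 * (x ^ (2 * Suc n) + y ^ (2 * Suc n))"
    by (simp only: ge2)
  also have "\<dots> = x ^ (2 * Suc (Suc (Suc n))) + y ^ (2 * Suc (Suc (Suc n)))"
    by (simp add: power2_eq_square algebra_simps)
  finally show ?case .
qed

text \<open>With N = \<open>Suc n + k\<close>, absorption makes the second binomial
  (\<open>Suc n\<close> - k)/N times the first, and 1 + (\<open>Suc n\<close> - k)/N = 2
  \<open>Suc n\<close>/N.\<close>

lemma waring_coefficient:
  assumes "k \<le> Suc n"
  shows "real (Suc n) / real (Suc n + k) * real ((Suc n + k) choose (Suc n - k)) =
    (real ((Suc n + k) choose (2 * k)) + real ((n + k) choose (2 * k))) / 2"
proof -
  have sym: "(Suc n + k) choose (Suc n - k) = (Suc n + k) choose (2 * k)"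
    using binomial_symmetric [of "2 * k" "Suc n + k"] assms
    by (simp add: mult_2)
  have "(Suc n + k - 2 * k) * ((Suc n + k) choose (2 * k)) =
      (Suc n + k) * ((n + k) choose (2 * k))"
    using binomial_absorb_comp [of "Suc n + k" "2 * k"] by simp
  then have "real (Suc n + k - 2 * k) * real ((Suc n + k) choose (2 * k)) =
      real (Suc n + k) * real ((n + k) choose (2 * k))"
    unfolding of_nat_mult [symmetric] by (simp only:)
  moreover have "real (Suc n + k - 2 * k) = real (Suc n) - real k"
    using assms by (simp add: of_nat_diff)
  ultimately have "(real (Suc n) - real k) * real ((Suc n + k) choose (2 * k)) =
      real (Suc n + k) * real ((n + k) choose (2 * k))"
    by (simp only:)
  then show ?thesis
    unfolding sym by (simp add: field_simps del: binomial_Suc_Suc)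
qed

lemma waring_identity:
  fixes x y :: real
  assumes "n > 0"
  shows "(\<Sum>k=0..n. real n / real (n + k) * real ((n + k) choose (n - k))
      * (x * y) ^ (n - k) * ((x - y)\<^sup>2) ^ k) = (x ^ (2 * n) + y ^ (2 * n)) / 2"
proof -
  \<comment> \<open>Positivity matters: at n = 0 the only summand contains 0/0 = 0, while the right
    side is 1.\<close>
  obtain m where n: "n = Suc m"
    using assms gr0_conv_Suc by blast
  have "(\<Sum>k=0..n. real n / real (n + k) * real ((n + k) choose (n - k))
      * (x * y) ^ (n - k) * ((x - y)\<^sup>2) ^ k) =
    (\<Sum>k\<le>Suc m. (real ((Suc m + k) choose (2 * k)) + real ((m + k) choose (2 * k))) / 2
      * (x * y) ^ (Suc m - k) * ((x - y)\<^sup>2) ^ k)"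
    unfolding n atLeast0AtMost by (intro sum.cong refl) (simp only: atMost_iff waring_coefficient)
  also have "\<dots> = (even_binomial_sum (Suc m) (x * y) ((x - y)\<^sup>2)
      + x * y * even_binomial_sum m (x * y) ((x - y)\<^sup>2)) / 2"
    unfolding mult_even_binomial_sum
    unfolding even_binomial_sum_def sum.distrib [symmetric] sum_divide_distrib
    by (intro sum.cong refl) (simp only: add_divide_distrib distrib_right times_divide_eq_left)
  finally show ?thesis
    by (simp only: even_binomial_sum_power_sum n)
qed

subsection \<open>Binet's formulas for integer indices\<close>

lemma int_recurrence_unique:
  fixes f g :: "int \<Rightarrow> real"
  assumes f: "\<And>m. f m = f (m - 1) + f (m - 2)"
    and g: "\<And>m. g m = g (m - 1) + g (m - 2)"
    and "f 0 = g 0" "f 1 = g 1"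
  shows "f m = g m"
proof -
  \<comment> \<open>Two consecutive values determine the sequence in both directions, so the
    induction carries a pair.\<close>
  have "f m = g m \<and> f (m + 1) = g (m + 1)"
  proof (induction m rule: int_induct [where k = 0])
    case base
    show ?case using assms(3,4) by simp
  next
    case (step1 i)
    then show ?case using f [of "i + 2"] g [of "i + 2"] by (simp add: add.commute)
  next
    \<comment> \<open>Downwards, the recurrence at \<open>i + 1\<close> is solved for the value at
      \<open>i - 1\<close>.\<close>
    case (step2 i)
    then show ?case using f [of "i + 1"] g [of "i + 1"] by simp
  qed
  then show ?thesis ..
qed

lemma powi_golden_recurrence:
  fixes r :: real
  assumes "r\<^sup>2 = r + 1"
  shows "r powi m = r powi (m - 1) + r powi (m - 2)"
proof -
  have "r \<noteq> 0" using assms by auto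
  then have "r powi m = r powi (m - 2) * r\<^sup>2" "r powi (m - 1) = r powi (m - 2) * r"
    using power_int_add [of r "m - 2" 2] power_int_add [of r "m - 2" 1] by simp_all
  then show ?thesis using assms by (simp add: algebra_simps)
qed

definition golden :: real where "golden = (1 + sqrt 5) / 2"
definition golden_conj :: real where "golden_conj = (1 - sqrt 5) / 2"

lemma golden_square: "golden\<^sup>2 = golden + 1" "golden_conj\<^sup>2 = golden_conj + 1"
  by (simp_all add: golden_def golden_conj_def power2_eq_square field_simps)

lemma golden_nonzero: "golden \<noteq> 0" "golden_conj \<noteq> 0"
  using golden_square by auto

lemma lucasZ_binet: "real_of_int (lucasZ m) = golden powi m + golden_conj powi m"
proof (rule int_recurrence_unique [where f = "\<lambda>m. real_of_int (lucasZ m)"])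
  show "real_of_int (lucasZ m) = real_of_int (lucasZ (m - 1)) + real_of_int (lucasZ (m - 2))" for m
    by (subst lucasZ_rec) simp
  show "golden powi m + golden_conj powi m = golden powi (m - 1) + golden_conj powi (m - 1)
      + (golden powi (m - 2) + golden_conj powi (m - 2))" for m
    using powi_golden_recurrence [OF golden_square(1), of m]
      powi_golden_recurrence [OF golden_square(2), of m] by linarith
qed (simp_all add: lucasZ_def golden_def golden_conj_def field_simps)

lemma fibZ_binet: "real_of_int (fibZ m) = (golden powi m - golden_conj powi m) / sqrt 5"
proof (rule int_recurrence_unique [where f = "\<lambda>m. real_of_int (fibZ m)"])
  show "real_of_int (fibZ m) = real_of_int (fibZ (m - 1)) + real_of_int (fibZ (m - 2))" for m
    by (subst fibZ_rec) simp
  show "(golden powi m - golden_conj powi m) / sqrt 5 =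
      (golden powi (m - 1) - golden_conj powi (m - 1)) / sqrt 5
      + (golden powi (m - 2) - golden_conj powi (m - 2)) / sqrt 5" for m
    using powi_golden_recurrence [OF golden_square(1), of m]
      powi_golden_recurrence [OF golden_square(2), of m]
    by (simp add: diff_divide_distrib add_divide_distrib)
qed (simp_all add: fibZ_def golden_def golden_conj_def field_simps)

lemma golden_powi_mult_conj: "golden powi m * golden_conj powi m = (-1) powi m"
proof -
  have "golden * golden_conj = -1" by (simp add: golden_def golden_conj_def field_simps)
  then show ?thesis unfolding power_int_mult_distrib [symmetric] by simp
qed

lemma golden_powi_add:
  "golden powi (m + l) = golden powi m * golden powi l"
  "golden_conj powi (m + l) = golden_conj powi m * golden_conj powi l"
  by (simp_all add: power_int_add golden_nonzero)

text \<open>Write a, b for the two roots. Replacing (-1)^q by a^q b^q cancels the mixed terms a^q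
  b^(p+q) in the first identity, leaving a^(p+q) (a^q - b^q) / sqrt 5; the second is
  analogous.\<close>

lemma fibZ_golden_addition:
  "real_of_int (fibZ (p + q)) * golden powi q - (-1) powi q * real_of_int (fibZ p)
    = real_of_int (fibZ q) * golden powi (p + q)"
  "real_of_int (fibZ (p + q)) * golden_conj powi q - (-1) powi q * real_of_int (fibZ p)
    = real_of_int (fibZ q) * golden_conj powi (p + q)"
  unfolding fibZ_binet golden_powi_mult_conj [symmetric] golden_powi_add
  by (simp_all add: divide_simps) (simp_all add: algebra_simps)

text \<open>The same cancellation, but the conjugate root yields the opposite sign, which disappears
  on squaring.\<close>

lemma lucasZ_golden_addition:
  "real_of_int (lucasZ (p + q)) * golden powi q - (-1) powi q * real_of_int (lucasZ p)
    = sqrt 5 * real_of_int (fibZ q) * golden powi (p + q)"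
  "real_of_int (lucasZ (p + q)) * golden_conj powi q - (-1) powi q * real_of_int (lucasZ p)
    = - sqrt 5 * real_of_int (fibZ q) * golden_conj powi (p + q)"
proof -
  have f: "sqrt 5 * real_of_int (fibZ q) = golden powi q - golden_conj powi q"
    by (simp add: fibZ_binet)
  show "real_of_int (lucasZ (p + q)) * golden powi q - (-1) powi q * real_of_int (lucasZ p)
      = sqrt 5 * real_of_int (fibZ q) * golden powi (p + q)"
    and "real_of_int (lucasZ (p + q)) * golden_conj powi q - (-1) powi q * real_of_int (lucasZ p)
      = - sqrt 5 * real_of_int (fibZ q) * golden_conj powi (p + q)"
    unfolding mult_minus_left f lucasZ_binet golden_powi_mult_conj [symmetric] golden_powi_add
    by (simp_all add: algebra_simps)
qed

subsection \<open>The identity for one root\<close>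

text \<open>\<open>U\<close> and \<open>V\<close> stand for either Fibonacci or Lucas values. Only
  the square of x - y enters \<open>waring_identity\<close>, so \<open>D\<close> is stated for
  squares and covers both signs.\<close>

lemma waring_identity_powi:
  fixes r U V C :: real and p q t :: int
  assumes "n > 0" and r: "r \<noteq> 0"
    and D: "(U * r powi q - (-1) powi q * V)\<^sup>2 = C * (r powi (p + q))\<^sup>2"
  shows "(\<Sum>k=0..n. (-1) powi ((int n - int k) * q) * real n / real (n + k)
        * real ((n + k) choose (n - k)) * U ^ (n - k) * V ^ (n - k) * C ^ k
        * r powi (int k * (2 * p + q) + t))
      = 1 / 2 * (U ^ (2 * n) * r powi (t + q * int n) + V ^ (2 * n) * r powi (t - q * int n))"
proof -
  let ?s = "(-1 :: real) powi q"
  let ?x = "U * r powi q" and ?y = "?s * V" and ?e = "r powi (t - q * int n)"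
  have s2: "?s\<^sup>2 = 1"
    by (simp add: power_int_minus_left)
  have summand: "(-1) powi ((int n - int k) * q) * real n / real (n + k)
        * real ((n + k) choose (n - k)) * U ^ (n - k) * V ^ (n - k) * C ^ k
        * r powi (int k * (2 * p + q) + t)
      = real n / real (n + k) * real ((n + k) choose (n - k))
        * (?x * ?y) ^ (n - k) * ((?x - ?y)\<^sup>2) ^ k * ?e" if "k \<le> n" for k
  proof -
    have s: "(-1 :: real) powi ((int n - int k) * q) = ?s ^ (n - k)"
      using that by (simp only: power_int_mult [symmetric] power_int_of_nat [symmetric] of_nat_diff
          mult.commute [of q])
    have "(r powi q) ^ (n - k) * ((r powi (p + q))\<^sup>2) ^ k * ?e =
        r powi (q * int (n - k)) * r powi ((p + q) * int (2 * k)) * ?e"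
      by (simp only: power_int_mult power_int_of_nat power_mult)
    also have "\<dots> = r powi (q * int (n - k) + (p + q) * int (2 * k) + (t - q * int n))"
      using r by (simp add: power_int_add [symmetric] del: of_nat_mult)
    \<comment> \<open>The shift by \<open>- q * int n\<close> in the extra factor cancels the
      n-dependence of the exponent.\<close>
    also have "q * int (n - k) + (p + q) * int (2 * k) + (t - q * int n)
        = int k * (2 * p + q) + t"
      using that by (simp add: of_nat_diff algebra_simps)
    finally have "r powi (int k * (2 * p + q) + t) =
        (r powi q) ^ (n - k) * ((r powi (p + q))\<^sup>2) ^ k * ?e" ..
    then show ?thesis
      unfolding s D by (simp only: power_mult_distrib mult_ac times_divide_eq_left times_divide_eq_right)
  qed
  have "(\<Sum>k=0..n. (-1) powi ((int n - int k) * q) * real n / real (n + k)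
        * real ((n + k) choose (n - k)) * U ^ (n - k) * V ^ (n - k) * C ^ k
        * r powi (int k * (2 * p + q) + t))
      = (\<Sum>k=0..n. real n / real (n + k) * real ((n + k) choose (n - k))
        * (?x * ?y) ^ (n - k) * ((?x - ?y)\<^sup>2) ^ k) * ?e"
    unfolding sum_distrib_right by (intro sum.cong refl summand) simp
  also have "\<dots> = (?x ^ (2 * n) + ?y ^ (2 * n)) / 2 * ?e"
    by (simp only: waring_identity [OF \<open>n > 0\<close>])
  also have "?y ^ (2 * n) = V ^ (2 * n)"
    by (simp add: power_mult_distrib power_mult s2)
  also have "?x ^ (2 * n) = U ^ (2 * n) * r powi (q * int (2 * n))"
    by (simp only: power_mult_distrib power_int_mult power_int_of_nat)
  also have "(U ^ (2 * n) * r powi (q * int (2 * n)) + V ^ (2 * n)) / 2 * ?e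
      = 1 / 2 * (U ^ (2 * n) * (r powi (q * int (2 * n)) * ?e) + V ^ (2 * n) * ?e)"
    by (simp add: field_simps)
  also have "r powi (q * int (2 * n)) * ?e = r powi (t + q * int n)"
    using r power_int_add [of r "q * int (2 * n)" "t - q * int n"] by (simp add: algebra_simps)
  finally show ?thesis .
qed

text \<open>Since \<open>U\<close>, \<open>V\<close>, \<open>C\<close> are common to both roots,
  adding the two one-root identities gives the Lucas form; subtracting them and dividing by sqrt 5
  gives the Fibonacci form.\<close>

lemma waring_identity_lucasZ_fibZ:
  fixes U V C :: real and p q t :: int
  assumes "n > 0"
    and "(U * golden powi q - (-1) powi q * V)\<^sup>2 = C * (golden powi (p + q))\<^sup>2"
    and "(U * golden_conj powi q - (-1) powi q * V)\<^sup>2 = C * (golden_conj powi (p + q))\<^sup>2"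
  shows "(\<Sum>k=0..n. (-1) powi ((int n - int k) * q) * real n / real (n + k)
        * real ((n + k) choose (n - k)) * U ^ (n - k) * V ^ (n - k) * C ^ k
        * real_of_int (lucasZ (int k * (2 * p + q) + t)))
      = 1 / 2 * (U ^ (2 * n) * real_of_int (lucasZ (t + q * int n))
               + V ^ (2 * n) * real_of_int (lucasZ (t - q * int n)))" (is ?L)
    and "(\<Sum>k=0..n. (-1) powi ((int n - int k) * q) * real n / real (n + k)
        * real ((n + k) choose (n - k)) * U ^ (n - k) * V ^ (n - k) * C ^ k
        * real_of_int (fibZ (int k * (2 * p + q) + t)))
      = 1 / 2 * (U ^ (2 * n) * real_of_int (fibZ (t + q * int n))
               + V ^ (2 * n) * real_of_int (fibZ (t - q * int n)))" (is ?F)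
proof -
  note a = waring_identity_powi [OF assms(1) golden_nonzero(1) assms(2), of t]
  note b = waring_identity_powi [OF assms(1) golden_nonzero(2) assms(3), of t]
  show ?L
    \<comment> \<open>Distributivity is restricted to reals so that the integer index
      \<open>int k * (2 * p + q) + t\<close> stays intact and matches \<open>a\<close> and
      \<open>b\<close>.\<close>
    unfolding lucasZ_binet distrib_left [where 'a = real] sum.distrib a b by (simp add: algebra_simps)
  show ?F
    unfolding fibZ_binet times_divide_eq_right right_diff_distrib [where 'a = real] sum_divide_distrib [symmetric]
      sum_subtractf a b
    by (simp add: algebra_simps diff_divide_distrib add_divide_distrib)
qed

theorem theorem14:
  fixes n :: nat and p q t :: int
  assumes "n > 0"
  shows
    "(\<Sum>k=0..n. (-1) powi ((int n - int k) * q) * real n / real (n + k)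
        * real ((n + k) choose (n - k))
        * real_of_int (fibZ (p + q)) ^ (n - k) * real_of_int (fibZ p) ^ (n - k)
        * real_of_int (fibZ q) ^ (2 * k)
        * real_of_int (lucasZ (int k * (2 * p + q) + t)))
      = 1 / 2 * (real_of_int (fibZ (p + q)) ^ (2 * n) * real_of_int (lucasZ (t + q * int n))
               + real_of_int (fibZ p) ^ (2 * n) * real_of_int (lucasZ (t - q * int n)))
     \<and>
     (\<Sum>k=0..n. (-1) powi ((int n - int k) * q) * real n / real (n + k)
        * real ((n + k) choose (n - k))
        * real_of_int (fibZ (p + q)) ^ (n - k) * real_of_int (fibZ p) ^ (n - k)
        * real_of_int (fibZ q) ^ (2 * k)
        * real_of_int (fibZ (int k * (2 * p + q) + t)))
      = 1 / 2 * (real_of_int (fibZ (p + q)) ^ (2 * n) * real_of_int (fibZ (t + q * int n))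
               + real_of_int (fibZ p) ^ (2 * n) * real_of_int (fibZ (t - q * int n)))
     \<and>
     (\<Sum>k=0..n. (-1) powi ((int n - int k) * q) * real n / real (n + k)
        * real ((n + k) choose (n - k)) * 5 ^ k
        * real_of_int (lucasZ (p + q)) ^ (n - k) * real_of_int (lucasZ p) ^ (n - k)
        * real_of_int (fibZ q) ^ (2 * k)
        * real_of_int (lucasZ (int k * (2 * p + q) + t)))
      = 1 / 2 * (real_of_int (lucasZ (p + q)) ^ (2 * n) * real_of_int (lucasZ (t + q * int n))
               + real_of_int (lucasZ p) ^ (2 * n) * real_of_int (lucasZ (t - q * int n)))
     \<and>
     (\<Sum>k=0..n. (-1) powi ((int n - int k) * q) * real n / real (n + k)
        * real ((n + k) choose (n - k)) * 5 ^ k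
        * real_of_int (lucasZ (p + q)) ^ (n - k) * real_of_int (lucasZ p) ^ (n - k)
        * real_of_int (fibZ q) ^ (2 * k)
        * real_of_int (fibZ (int k * (2 * p + q) + t)))
      = 1 / 2 * (real_of_int (lucasZ (p + q)) ^ (2 * n) * real_of_int (fibZ (t + q * int n))
               + real_of_int (lucasZ p) ^ (2 * n) * real_of_int (fibZ (t - q * int n)))"
proof -
  \<comment> \<open>Squaring the addition formulas gives \<open>C\<close> as the square of
    \<open>fibZ q\<close>.\<close>
  note fib_sq = fibZ_golden_addition [of p q, THEN arg_cong [where f = "\<lambda>x. x\<^sup>2"],
      unfolded power_mult_distrib [of "real_of_int (fibZ q)"]]
  have lucas_sq:
    "(real_of_int (lucasZ (p + q)) * golden powi q - (-1) powi q * real_of_int (lucasZ p))\<^sup>2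
      = 5 * (real_of_int (fibZ q))\<^sup>2 * (golden powi (p + q))\<^sup>2"
    "(real_of_int (lucasZ (p + q)) * golden_conj powi q - (-1) powi q * real_of_int (lucasZ p))\<^sup>2
      = 5 * (real_of_int (fibZ q))\<^sup>2 * (golden_conj powi (p + q))\<^sup>2"
    unfolding lucasZ_golden_addition by (simp_all only: power_mult_distrib power2_minus) simp_all
  \<comment> \<open>Regroups the summand so that 5^k F_q^(2k) becomes \<open>C ^ k\<close> with C =
    5 F_q^2.\<close>
  have lucas_summand: "c * 5 ^ k * u * v * f ^ (2 * k) * g = c * u * v * (5 * f\<^sup>2) ^ k * g"
    for c u v f g :: real and k
    by (simp add: power_mult_distrib power_mult)
  show ?thesis
    unfolding lucas_summand
    unfolding power_mult [of "real_of_int (fibZ q)"]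
    by (intro conjI waring_identity_lucasZ_fibZ [OF assms fib_sq]
        waring_identity_lucasZ_fibZ [OF assms lucas_sq])
qed

end
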